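(* Fix an integer $j\ge 2$ and a real number $c>0$. The distribution of the number of $j$-cycles of the permutation in $S_n$ obtained after multiplying $\lfloor cn\rfloor$ independent random star transpositions, starting from the identity, converges to the Poisson$\left(\frac1j\left(1-e^{-jc}\right)\right)$ distribution as $n\to\infty$.
   Context: The star transposition walk on $S_n$ is driven by the probability measure $Q$ on $S_n$ with $Q(\pi)=\frac1{n-1}$ if $\pi$ is one of the transpositions $(1\,i)$, $2\le i\le n$, and $Q(\pi)=0$ otherwise. At each step one moves from $g$ to $hg$ with $h$ sampled independently from $Q$; after $k$ steps started at the identity the law of the permutation is the $k$-fold convolution $Q^{*k}$. Convergence is convergence in distribution. *)

theory Defs
  imports
    "HOL-Probability.Probability"
    "HOL-Combinatorics.Permutations"
    "HOL-Combinatorics.Orbits"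
begin

text \<open>
  The group \<open>S\<^sub>n\<close> is rendered as \<open>{\<pi>. \<pi> permutes {1..n}}\<close>, with composition as the product.
\<close>

definition star_transpositions :: "nat \<Rightarrow> (nat \<Rightarrow> nat) set" where
  "star_transpositions n = {Transposition.transpose 1 i | i. i \<in> {2..n}}"

text \<open>For \<open>n < 2\<close> there is no star transposition and \<open>star_pmf n\<close> is an unspecified pmf.\<close>

definition star_pmf :: "nat \<Rightarrow> (nat \<Rightarrow> nat) pmf" where
  "star_pmf n = pmf_of_set (star_transpositions n)"

definition convolution_pmf :: "('a \<Rightarrow> 'a) pmf \<Rightarrow> ('a \<Rightarrow> 'a) pmf \<Rightarrow> ('a \<Rightarrow> 'a) pmf" where
  "convolution_pmf P R = map_pmf (\<lambda>(h, g). h \<circ> g) (pair_pmf P R)"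

primrec convolution_power_pmf :: "('a \<Rightarrow> 'a) pmf \<Rightarrow> nat \<Rightarrow> ('a \<Rightarrow> 'a) pmf" where
  "convolution_power_pmf P 0 = return_pmf id"
| "convolution_power_pmf P (Suc k) = convolution_pmf P (convolution_power_pmf P k)"

text \<open>
  For a permutation \<open>\<pi>\<close> of a finite set, the sets \<open>C\<close> with \<open>cyclic_on \<pi> C\<close> are precisely the
  orbits of \<open>\<pi>\<close>, i.e. the supports of its cycles (fixed points giving the cycles of length 1).
\<close>

definition num_cycles :: "nat \<Rightarrow> nat \<Rightarrow> (nat \<Rightarrow> nat) \<Rightarrow> nat" where
  "num_cycles n j \<pi> = card {C. C \<subseteq> {1..n} \<and> card C = j \<and> cyclic_on \<pi> C}"

lemma inj_transpose_1: "inj_on (\<lambda>i::nat. Transposition.transpose 1 i) {2..n}"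
  by (rule inj_onI) (metis transpose_apply_first)

lemma star_transpositions_eq_image:
  "star_transpositions n = (\<lambda>i. Transposition.transpose 1 i) ` {2..n}"
  by (auto simp: star_transpositions_def)

lemma finite_star_transpositions [simp]: "finite (star_transpositions n)"
  by (simp add: star_transpositions_eq_image)

lemma card_star_transpositions: "card (star_transpositions n) = n - 1"
  by (simp only: star_transpositions_eq_image card_image[OF inj_transpose_1]) simp

lemma pmf_star_pmf:
  assumes "n \<ge> 2"
  shows "pmf (star_pmf n) \<pi> =
    (if \<pi> \<in> star_transpositions n then 1 / (real n - 1) else 0)"
proof -
  have "star_transpositions n \<noteq> {}"
    using assms by (auto simp: star_transpositions_eq_image)
  then show ?thesis
    using assms by (simp add: star_pmf_def card_star_transpositions of_nat_diff indicator_def)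
qed

lemma set_pmf_star_walk_permutes:
  assumes "n \<ge> 2" and "\<pi> \<in> set_pmf (convolution_power_pmf (star_pmf n) k)"
  shows "\<pi> permutes {1..n}"
  using assms(2)
proof (induction k arbitrary: \<pi>)
  case 0
  then show ?case by (simp add: permutes_def)
next
  case (Suc k)
  have ne: "star_transpositions n \<noteq> {}"
    using assms by (auto simp: star_transpositions_eq_image)
  from Suc.prems obtain h g where h: "h \<in> star_transpositions n"
    and g: "g \<in> set_pmf (convolution_power_pmf (star_pmf n) k)" and \<pi>: "\<pi> = h \<circ> g"
    by (auto simp: convolution_pmf_def star_pmf_def ne)
  from h have "h permutes {1..n}"
    by (auto simp: star_transpositions_def intro!: permutes_swap_id)
  then show ?case
    unfolding \<pi> by (rule permutes_compose[OF Suc.IH[OF g]])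
qed

end

theory Submission
  imports Defs "HOL-Real_Asymp.Real_Asymp"
begin

text \<open>
  Multiplying \<open>p\<close> on the left by \<open>(1 i)\<close> either merges the cycle of \<open>i\<close> into the cycle of \<open>1\<close>, or, if
  \<open>i = p\<^sup>q(1)\<close> with \<open>0 < q < L\<close> and \<open>L\<close> the length of the cycle of \<open>1\<close>, splits that cycle into one of
  length \<open>q\<close> through \<open>1\<close> and one of length \<open>L - q\<close>. Hence the number \<open>X\<close> of \<open>j\<close>-cycles avoiding \<open>1\<close>
  goes down by one for exactly \<open>j X\<close> of the \<open>n - 1\<close> choices of \<open>i\<close> and up by one for exactly one choice
  if \<open>L > j\<close> (for none otherwise). Moreover \<open>L \<le> m + 1\<close> after a step forces \<open>L \<le> m\<close> before it, except
  for \<open>m + 1\<close> choices of \<open>i\<close>, so \<open>L \<le> j\<close> has probability at most \<open>j\<^sup>2 / (n - 1)\<close> after \<open>j\<close> steps.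

  So \<open>X\<close> is nearly an immigration-death chain. With \<open>e = 1 / (n - 1)\<close>, one step satisfies
  \<open>E[(1 + u)\<^sup>X] = exp(e u) E[(1 + (1 - j e) u)\<^sup>X]\<close> up to an error \<open>O(e\<^sup>2)\<close>, where the left-hand side is
  taken after the step and the right-hand side before it. As
  \<open>\<bar>exp(e u)\<bar> \<le> 1\<close> whenever \<open>\<bar>1 + u\<bar> \<le> 1\<close>, iterating over \<open>c n\<close> steps accumulates only an error
  \<open>O(1 / n)\<close>, and the exponents add up to \<open>(z - 1) (1 - (1 - j e)\<^bsup>c n\<^esup>) / j\<close>. This gives the limit of
  the characteristic function.
\<close>

section \<open>Cycles under multiplication by a star transposition\<close>

lemma orbit_eq_funpow_image:
  fixes f :: "'a \<Rightarrow> 'a"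
  assumes "(f ^^ m) x = x" "0 < m"
  shows "orbit f x = (\<lambda>k. (f ^^ k) x) ` {..<m}"
  using orbit_altdef_bounded[OF assms] by auto

lemma permutes_self_in_orbit:
  assumes "p permutes S" "finite S"
  shows "x \<in> orbit p x"
  using assms by (intro permutation_self_in_orbit) (auto simp: permutation_permutes)

lemma permutes_orbit_sym:
  assumes "p permutes S" "finite S"
  shows "x \<in> orbit p y \<longleftrightarrow> y \<in> orbit p x"
  using orbit_swap[OF permutes_self_in_orbit[OF assms], of x y]
    orbit_swap[OF permutes_self_in_orbit[OF assms], of y x] by blast

lemma
  fixes x :: 'a
  assumes "p permutes S" "finite S"
  defines "L \<equiv> card (orbit p x)"
  shows card_orbit_pos: "0 < L"
    and funpow_card_orbit: "(p ^^ L) x = x"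
    and inj_on_funpow_orbit: "inj_on (\<lambda>k. (p ^^ k) x) {..<L}"
    and orbit_eq_funpow_card: "orbit p x = (\<lambda>k. (p ^^ k) x) ` {..<L}"
proof -
  note self = permutes_self_in_orbit[OF assms(1,2), of x]
  \<comment> \<open>The iterates before the first return enumerate the orbit without repetition, so
    the return time is the cardinality \<open>L\<close>.\<close>
  have L: "L = funpow_dist1 p x x"
    unfolding L_def by (subst orbit_conv_funpow_dist1[OF self], subst card_image[OF inj_on_funpow_dist1[OF self]]) simp
  show "0 < L" using L by simp
  show "(p ^^ L) x = x" using funpow_dist1_prop[OF self] L by simp
  show "inj_on (\<lambda>k. (p ^^ k) x) {..<L}"
    using inj_on_funpow_dist1[OF self] L by (simp add: atLeast0LessThan)
  show "orbit p x = (\<lambda>k. (p ^^ k) x) ` {..<L}"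
    using orbit_conv_funpow_dist1[OF self] L by (simp add: atLeast0LessThan)
qed

text \<open>A transposition moves only \<open>a\<close> and \<open>i\<close>, so the two
  trajectories cannot part before that of \<open>p\<close> hits one of them. Time \<open>0\<close>
  is exempt because the transposition acts after \<open>p\<close>; thus \<open>x\<close> itself may
  be \<open>a\<close> or \<open>i\<close>.\<close>

lemma funpow_transpose_comp:
  fixes p :: "'a \<Rightarrow> 'a"
  assumes "\<And>k. 0 < k \<Longrightarrow> k \<le> m \<Longrightarrow> (p ^^ k) x \<notin> {a, i}"
  shows "((Transposition.transpose a i \<circ> p) ^^ m) x = (p ^^ m) x"
  using assms
proof (induction m)
  case (Suc m)
  define t where "t = Transposition.transpose a i \<circ> p"
  have "(t ^^ m) x = (p ^^ m) x"
    unfolding t_def by (rule Suc.IH) (use Suc.prems in auto)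
  then have "(t ^^ Suc m) x = t ((p ^^ m) x)" by simp
  also have "\<dots> = Transposition.transpose a i ((p ^^ Suc m) x)" by (simp add: t_def)
  also have "\<dots> = (p ^^ Suc m) x"
    using Suc.prems[of "Suc m"] by (intro transpose_apply_other) auto
  finally show ?case by (simp only: t_def)
qed simp

section \<open>Splitting and merging the cycle through a fixed point\<close>

context
  fixes S :: "'a set" and a :: 'a and p :: "'a \<Rightarrow> 'a"
  assumes fin: "finite S" and a: "a \<in> S" and p: "p permutes S"
begin

lemma transpose_comp_permutes:
  assumes "i \<in> S"
  shows "Transposition.transpose a i \<circ> p permutes S"
  by (rule permutes_compose[OF p permutes_swap_id[OF a assms]])

text \<open>Write the cycle as \<open>a, p a, ...\<close> with \<open>i\<close> at position
  \<open>q\<close>. The move that would enter \<open>i\<close> is redirected to \<open>a\<close>,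
  and the one that would return to \<open>a\<close> is redirected to \<open>i\<close>, so the
  positions below \<open>q\<close> and those from \<open>q\<close> on close up separately.\<close>

lemma split_orbit:
  fixes q :: nat
  assumes q: "0 < q" "q < card (orbit p a)"
  defines "i \<equiv> (p ^^ q) a"
  shows "orbit (Transposition.transpose a i \<circ> p) a = (\<lambda>k. (p ^^ k) a) ` {..<q}"
    and "orbit (Transposition.transpose a i \<circ> p) i = (\<lambda>k. (p ^^ k) a) ` {q..<card (orbit p a)}"
proof -
  define L where "L = card (orbit p a)"
  define t where "t = Transposition.transpose a i \<circ> p"
  note inj = inj_on_funpow_orbit[OF p fin, of a, folded L_def]
  have neq: "(p ^^ k) a \<notin> {a, i}" if "0 < k" "k < L" "k \<noteq> q" for k
    using inj_onD[OF inj, of k 0] inj_onD[OF inj, of k q] that q L_def i_def by auto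
  have "(t ^^ k) a = (p ^^ k) a" if "k < q" for k
    unfolding t_def using that q L_def by (intro funpow_transpose_comp neq) auto
  moreover have "(t ^^ q) a = a"
  proof -
    obtain q' where q': "q = Suc q'" using q by (cases q) auto
    then have "(t ^^ q) a = t ((p ^^ q') a)" using \<open>\<And>k. k < q \<Longrightarrow> (t ^^ k) a = (p ^^ k) a\<close> by simp
    also have "\<dots> = Transposition.transpose a i ((p ^^ q) a)" by (simp add: t_def q')
    finally show ?thesis by (simp add: i_def)
  qed
  ultimately show "orbit (Transposition.transpose a i \<circ> p) a = (\<lambda>k. (p ^^ k) a) ` {..<q}"
    using orbit_eq_funpow_image[of q t a] q(1) by (simp add: t_def)
  have pi: "(p ^^ k) i = (p ^^ (k + q)) a" for k by (simp add: i_def funpow_add)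
  have *: "(t ^^ k) i = (p ^^ (k + q)) a" if "k < L - q" for k
    unfolding t_def pi[symmetric] using that q L_def
    by (intro funpow_transpose_comp) (unfold pi, intro neq, auto)
  moreover have "(t ^^ (L - q)) i = i"
  proof -
    obtain l where l: "L - q = Suc l" using q L_def by (metis Suc_diff_Suc)
    then have "(t ^^ (L - q)) i = t ((p ^^ (l + q)) a)" using *[of l] by simp
    also have "\<dots> = Transposition.transpose a i ((p ^^ Suc (l + q)) a)" by (simp add: t_def)
    also have "Suc (l + q) = L" using l by simp
    finally show ?thesis using funpow_card_orbit[OF p fin, of a] by (simp add: L_def)
  qed
  ultimately have "orbit t i = (\<lambda>k. (p ^^ (k + q)) a) ` {..<L - q}"
    using orbit_eq_funpow_image[of "L - q" t i] q L_def by simp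
  also have "\<dots> = (\<lambda>k. (p ^^ k) a) ` (\<lambda>k. k + q) ` {..<L - q}" by (simp add: image_image)
  also have "(\<lambda>k. k + q) ` {..<L - q} = {q..<L}"
    using q L_def by (simp add: lessThan_atLeast0 add.commute[of _ q])
  finally show "orbit (Transposition.transpose a i \<circ> p) i = (\<lambda>k. (p ^^ k) a) ` {q..<card (orbit p a)}"
    unfolding t_def L_def .
qed

lemma card_split_orbit:
  fixes q :: nat
  assumes q: "0 < q" "q < card (orbit p a)"
  defines "i \<equiv> (p ^^ q) a"
  shows "card (orbit (Transposition.transpose a i \<circ> p) a) = q"
    and "card (orbit (Transposition.transpose a i \<circ> p) i) = card (orbit p a) - q"
proof -
  note inj = inj_on_funpow_orbit[OF p fin, of a]
  show "card (orbit (Transposition.transpose a i \<circ> p) a) = q"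
    unfolding i_def split_orbit(1)[OF q] using q
    by (subst card_image) (auto intro: inj_on_subset[OF inj])
  show "card (orbit (Transposition.transpose a i \<circ> p) i) = card (orbit p a) - q"
    unfolding i_def split_orbit(2)[OF q] using q
    by (subst card_image) (auto intro: inj_on_subset[OF inj])
qed

lemma split_not_in_orbit:
  assumes q: "0 < q" "q < card (orbit p a)"
  shows "(p ^^ q) a \<notin> orbit (Transposition.transpose a ((p ^^ q) a) \<circ> p) a"
proof
  assume "(p ^^ q) a \<in> orbit (Transposition.transpose a ((p ^^ q) a) \<circ> p) a"
  then obtain k where "k < q" "(p ^^ q) a = (p ^^ k) a"
    unfolding split_orbit(1)[OF q] by auto
  then show False
    using q inj_onD[OF inj_on_funpow_orbit[OF p fin, of a], of q k] by auto
qed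

lemma in_orbit_funpowE:
  assumes "i \<in> orbit p a" "i \<noteq> a"
  obtains q where "0 < q" "q < card (orbit p a)" "i = (p ^^ q) a"
proof -
  obtain q where "q < card (orbit p a)" "i = (p ^^ q) a"
    using subsetD[OF equalityD1[OF orbit_eq_funpow_card[OF p fin]] assms(1)] by blast
  moreover from this have "0 < q" using assms(2) by (cases q) auto
  ultimately show thesis using that by blast
qed

text \<open>The trajectory from \<open>a\<close> runs through the whole old cycle and, where it
  would return to \<open>a\<close>, is sent to \<open>i\<close>. The inclusion is enough: it shows
  that \<open>i\<close> joins the cycle and that the cycle gets strictly longer.\<close>

lemma merge_orbit:
  assumes i: "i \<notin> orbit p a"
  shows "insert i (orbit p a) \<subseteq> orbit (Transposition.transpose a i \<circ> p) a"
proof -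
  define L where "L = card (orbit p a)"
  define t where "t = Transposition.transpose a i \<circ> p"
  note inj = inj_on_funpow_orbit[OF p fin, of a, folded L_def]
  note orb = orbit_eq_funpow_card[OF p fin, of a, folded L_def]
  have neq: "(p ^^ k) a \<notin> {a, i}" if "0 < k" "k < L" for k
    using inj_onD[OF inj, of k 0] that i orb by auto
  have *: "(t ^^ k) a = (p ^^ k) a" if "k < L" for k
    unfolding t_def using that by (intro funpow_transpose_comp neq) auto
  have L0: "0 < L" using card_orbit_pos[OF p fin] by (simp add: L_def)
  then obtain l where l: "L = Suc l" by (cases L) auto
  have "(t ^^ L) a = t ((p ^^ l) a)" using *[of l] l by simp
  also have "\<dots> = Transposition.transpose a i ((p ^^ L) a)" by (simp add: t_def l)
  also have "\<dots> = i" using funpow_card_orbit[OF p fin, of a] by (simp add: L_def)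
  finally have tL: "(t ^^ L) a = i" .
  have "i \<in> orbit t a" unfolding orbit_altdef using tL L0 by blast
  moreover have "a \<in> orbit t a"
  proof (cases "i \<in> S")
    case True
    show ?thesis unfolding t_def
      by (rule permutes_self_in_orbit[OF transpose_comp_permutes[OF True] fin])
  next
    case False
    \<comment> \<open>For \<open>i\<close> outside \<open>S\<close>, \<open>p\<close> fixes
      \<open>i\<close>, so everything takes place in the enlarged finite set.\<close>
    have "t permutes insert i S"
      unfolding t_def using a
      by (intro permutes_compose[of p "insert i S"] permutes_swap_id permutes_subset[OF p]) auto
    then show ?thesis using permutes_self_in_orbit[of t "insert i S" a] fin by simp
  qed
  moreover have "(p ^^ k) a \<in> orbit t a" if "k < L" for k
    using *[OF that] funpow_in_orbit[OF \<open>a \<in> orbit t a\<close>] by metis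
  ultimately show ?thesis unfolding t_def[symmetric] by (auto simp: orb)
qed

lemma card_merge_orbit:
  assumes i: "i \<in> S" "i \<notin> orbit p a"
  shows "card (orbit p a) < card (orbit (Transposition.transpose a i \<circ> p) a)"
proof -
  have "finite (orbit (Transposition.transpose a i \<circ> p) a)"
    using permutes_self_in_orbit[OF transpose_comp_permutes[OF i(1)] fin] by (rule finite_orbit)
  then show ?thesis
    using merge_orbit[OF i(2)] i(2) by (intro psubset_card_mono) auto
qed

end

text \<open>Away from \<open>a\<close>, a multiplication by \<open>(a i)\<close> can only absorb one
  whole cycle or cut off one new cycle, so this count moves by at most one per step.\<close>

definition cycles_avoiding :: "'a set \<Rightarrow> 'a \<Rightarrow> nat \<Rightarrow> ('a \<Rightarrow> 'a) \<Rightarrow> 'a set set" where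
  "cycles_avoiding S a j p = {C. C \<subseteq> S \<and> card C = j \<and> cyclic_on p C \<and> a \<notin> C}"

lemma finite_cycles_avoiding: "finite S \<Longrightarrow> finite (cycles_avoiding S a j p)"
  unfolding cycles_avoiding_def by (rule finite_subset[of _ "Pow S"]) auto

text \<open>The only cycle that can contain \<open>i\<close> is its orbit. Setting it apart leaves
  the cycles that multiplication by \<open>(a i)\<close> does not touch, a part common to
  \<open>p\<close> and its successor.\<close>

lemma card_cycles_avoiding:
  assumes "finite S" "p permutes S" "i \<in> S"
  shows "card (cycles_avoiding S a j p) = card {C \<in> cycles_avoiding S a j p. i \<notin> C} +
    (if i \<notin> orbit p a \<and> card (orbit p i) = j then 1 else 0)"
proof -
  have "{C \<in> cycles_avoiding S a j p. i \<in> C} =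
      (if i \<notin> orbit p a \<and> card (orbit p i) = j then {orbit p i} else {})" (is "?K = ?R")
  proof (intro set_eqI iffI)
    fix C assume C: "C \<in> ?K"
    then have "C = orbit p i"
      using orbit_cyclic_eq3[of p C i] by (simp add: cycles_avoiding_def)
    then show "C \<in> ?R"
      using C permutes_orbit_sym[OF assms(2,1), of a i] by (simp add: cycles_avoiding_def)
  next
    fix C assume "C \<in> ?R"
    then have "C = orbit p i" "i \<notin> orbit p a" "card (orbit p i) = j"
      by (auto split: if_splits)
    then show "C \<in> ?K"
      using permutes_orbit_sym[OF assms(2,1), of a i] permutes_self_in_orbit[OF assms(2,1), of i]
        permutes_orbit_subset[OF assms(2,3)] cyclic_on_orbit[OF assms(2,1)]
      by (simp add: cycles_avoiding_def)
  qed
  moreover have "card (cycles_avoiding S a j p) =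
      card {C \<in> cycles_avoiding S a j p. i \<notin> C} + card {C \<in> cycles_avoiding S a j p. i \<in> C}"
    using finite_cycles_avoiding[OF assms(1), of a j p]
    by (subst card_Un_disjoint[symmetric]) (auto intro: arg_cong[where f = card])
  ultimately show ?thesis by simp
qed

text \<open>Images of points of \<open>C\<close> stay in \<open>C\<close>, where the transposition
  is trivial. The converse is the same implication for the product, since the transposition is an
  involution.\<close>

lemma cyclic_on_transpose_comp:
  assumes "a \<notin> C" "i \<notin> C"
  shows "cyclic_on (Transposition.transpose a i \<circ> p) C \<longleftrightarrow> cyclic_on p C"
proof -
  have *: "cyclic_on (Transposition.transpose a i \<circ> r) C" if "cyclic_on r C" for r
  proof -
    have "(Transposition.transpose a i \<circ> r) x = r x" if "x \<in> C" for x
      using cyclic_on_inI[OF \<open>cyclic_on r C\<close> that] assms by (auto intro!: transpose_apply_other)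
    then show ?thesis using cyclic_cong[of C "Transposition.transpose a i \<circ> r" r] that by blast
  qed
  have "Transposition.transpose a i \<circ> (Transposition.transpose a i \<circ> p) = p"
    by (simp add: fun_eq_iff)
  then show ?thesis
    using *[of p] *[of "Transposition.transpose a i \<circ> p"] by auto
qed

section \<open>Counting the choices of \<open>i\<close> that change the cycle count\<close>

context
  fixes S :: "'a set" and a :: 'a and p :: "'a \<Rightarrow> 'a"
  assumes fin: "finite S" and a: "a \<in> S" and p: "p permutes S"
begin

text \<open>Both counts share the cycles without \<open>i\<close>. After a split \<open>i\<close>
  has left the cycle of \<open>a\<close>, so its orbit may be new; after a merge \<open>i\<close>
  lies in the cycle of \<open>a\<close>, so its old orbit is lost. The subtraction never truncates,
  as that old orbit was counted.\<close>

lemma card_cycles_avoiding_step: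
  assumes i: "i \<in> S" "i \<noteq> a"
  defines "t \<equiv> Transposition.transpose a i \<circ> p"
  shows "i \<in> orbit p a \<Longrightarrow> card (cycles_avoiding S a j t) =
      card (cycles_avoiding S a j p) + (if card (orbit t i) = j then 1 else 0)"
    and "i \<notin> orbit p a \<Longrightarrow> card (cycles_avoiding S a j t) =
      card (cycles_avoiding S a j p) - (if card (orbit p i) = j then 1 else 0)"
proof -
  have t: "t permutes S" unfolding t_def by (rule transpose_comp_permutes[OF fin a p i(1)])
  have eq: "{C \<in> cycles_avoiding S a j t. i \<notin> C} = {C \<in> cycles_avoiding S a j p. i \<notin> C}"
    by (auto simp: cycles_avoiding_def t_def cyclic_on_transpose_comp)
  note P = card_cycles_avoiding[OF fin p i(1), of a j]
  note T = card_cycles_avoiding[OF fin t i(1), of a j, unfolded eq]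
  show "card (cycles_avoiding S a j t) =
      card (cycles_avoiding S a j p) + (if card (orbit t i) = j then 1 else 0)"
    if "i \<in> orbit p a"
  proof -
    obtain q where q: "0 < q" "q < card (orbit p a)" "i = (p ^^ q) a"
      using in_orbit_funpowE[OF fin a p \<open>i \<in> orbit p a\<close> i(2)] .
    have "i \<notin> orbit t a"
      unfolding t_def q(3) by (rule split_not_in_orbit[OF fin a p q(1,2)])
    then show ?thesis using P T that by simp
  qed
  show "card (cycles_avoiding S a j t) =
      card (cycles_avoiding S a j p) - (if card (orbit p i) = j then 1 else 0)"
    if "i \<notin> orbit p a"
    using merge_orbit[OF fin a p that] P T that unfolding t_def[symmetric] by simp
qed

text \<open>A cut at position \<open>q\<close> severs a piece of length
  \<open>card (orbit p a) - q\<close>, which determines \<open>q\<close>; the requirement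
  \<open>0 < q\<close> becomes \<open>j < card (orbit p a)\<close>.\<close>

lemma card_births:
  assumes "0 < j"
  shows "card {i \<in> S - {a}. i \<in> orbit p a \<and> card (orbit (Transposition.transpose a i \<circ> p) i) = j}
    = (if j < card (orbit p a) then 1 else 0)" (is "card ?V = _")
proof -
  have "?V = (if j < card (orbit p a) then {(p ^^ (card (orbit p a) - j)) a} else {})"
  proof (intro set_eqI iffI)
    fix i assume "i \<in> ?V"
    then obtain q where q: "0 < q" "q < card (orbit p a)" "i = (p ^^ q) a"
      using in_orbit_funpowE[OF fin a p] by blast
    with \<open>i \<in> ?V\<close> have "card (orbit p a) - q = j"
      using card_split_orbit(2)[OF fin a p q(1,2)] by simp
    then have "q = card (orbit p a) - j" "j < card (orbit p a)" using q by auto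
    then show "i \<in> (if j < card (orbit p a) then {(p ^^ (card (orbit p a) - j)) a} else {})"
      using q by simp
  next
    fix i assume "i \<in> (if j < card (orbit p a) then {(p ^^ (card (orbit p a) - j)) a} else {})"
    then have j: "j < card (orbit p a)" and i: "i = (p ^^ (card (orbit p a) - j)) a"
      by (auto split: if_splits)
    define q where "q = card (orbit p a) - j"
    have q: "0 < q" "q < card (orbit p a)" using j assms by (auto simp: q_def)
    have "i \<in> orbit p a"
      using i funpow_in_orbit[OF permutes_self_in_orbit[OF p fin]] by simp
    moreover have "i \<in> S" using permutes_orbit_subset[OF p a] \<open>i \<in> orbit p a\<close> by blast
    moreover have "i \<noteq> a"
      using inj_onD[OF inj_on_funpow_orbit[OF p fin, of a], of q 0] q i by (auto simp: q_def)
    ultimately show "i \<in> ?V"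
      using card_split_orbit(2)[OF fin a p q] j i by (simp add: q_def)
  qed
  then show ?thesis by simp
qed

text \<open>The lethal choices of \<open>i\<close> fill the union of the counted cycles, which are
  disjoint and have \<open>j\<close> points each.\<close>

lemma card_deaths:
  "card {i \<in> S - {a}. i \<notin> orbit p a \<and> card (orbit p i) = j} = j * card (cycles_avoiding S a j p)"
    (is "card ?U = _")
proof -
  have "?U = \<Union> (cycles_avoiding S a j p)"
  proof (intro set_eqI iffI)
    fix i assume i: "i \<in> ?U"
    then have "orbit p i \<in> cycles_avoiding S a j p"
      using permutes_orbit_sym[OF p fin, of a i] permutes_orbit_subset[OF p] cyclic_on_orbit[OF p fin]
      by (simp add: cycles_avoiding_def)
    then show "i \<in> \<Union> (cycles_avoiding S a j p)"
      using permutes_self_in_orbit[OF p fin] by blast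
  next
    fix i assume "i \<in> \<Union> (cycles_avoiding S a j p)"
    then obtain C where C: "C \<subseteq> S" "card C = j" "cyclic_on p C" "a \<notin> C" "i \<in> C"
      by (auto simp: cycles_avoiding_def)
    then have "orbit p i = C" using orbit_cyclic_eq3[of p C i] by simp
    then show "i \<in> ?U"
      using C permutes_orbit_sym[OF p fin, of a i] by auto
  qed
  moreover have "card (\<Union> (cycles_avoiding S a j p)) = (\<Sum>C\<in>cycles_avoiding S a j p. card C)"
  proof (rule card_Union_disjoint)
    show "disjoint (cycles_avoiding S a j p)"
    proof (rule disjointI)
      fix C D assume CD: "C \<in> cycles_avoiding S a j p" "D \<in> cycles_avoiding S a j p" "C \<noteq> D"
      show "C \<inter> D = {}"
      proof (rule ccontr)
        assume "C \<inter> D \<noteq> {}"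
        then obtain i where "i \<in> C" "i \<in> D" by blast
        then have "orbit p i = C" "orbit p i = D"
          using CD orbit_cyclic_eq3[of p _ i] by (simp_all add: cycles_avoiding_def)
        then show False using CD by simp
      qed
    qed
  qed (auto simp: cycles_avoiding_def intro: finite_subset[OF _ fin])
  ultimately show ?thesis by (simp add: cycles_avoiding_def)
qed

text \<open>After division by \<open>card S - 1\<close> this is the one-step transition operator of
  an immigration-death chain, with immigration blocked while the cycle of \<open>a\<close> is short.
  At \<open>X = 0\<close> the term \<open>f (X - 1)\<close> has coefficient zero.\<close>

lemma sum_step_cycles_avoiding:
  fixes f :: "nat \<Rightarrow> 'b :: real_algebra_1"
  assumes "0 < j"
  defines "X \<equiv> card (cycles_avoiding S a j p)"
  shows "(\<Sum>i\<in>S - {a}. f (card (cycles_avoiding S a j (Transposition.transpose a i \<circ> p)))) =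
    of_nat (card S - 1) * f X + of_nat (j * X) * (f (X - 1) - f X) +
    (if j < card (orbit p a) then f (X + 1) - f X else 0)"
proof -
  let ?U = "\<lambda>i. i \<notin> orbit p a \<and> card (orbit p i) = j"
  let ?V = "\<lambda>i. i \<in> orbit p a \<and> card (orbit (Transposition.transpose a i \<circ> p) i) = j"
  have "(\<Sum>i\<in>S - {a}. f (card (cycles_avoiding S a j (Transposition.transpose a i \<circ> p)))) =
    (\<Sum>i\<in>S - {a}. f X + (if ?U i then f (X - 1) - f X else 0) + (if ?V i then f (X + 1) - f X else 0))"
  proof (intro sum.cong refl)
    fix i assume "i \<in> S - {a}"
    then have i: "i \<in> S" "i \<noteq> a" by auto
    show "f (card (cycles_avoiding S a j (Transposition.transpose a i \<circ> p))) =
      f X + (if ?U i then f (X - 1) - f X else 0) + (if ?V i then f (X + 1) - f X else 0)"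
      using card_cycles_avoiding_step[OF i] by (cases "i \<in> orbit p a") (simp_all add: X_def)
  qed
  also have "\<dots> = of_nat (card S - 1) * f X + of_nat (card {i \<in> S - {a}. ?U i}) * (f (X - 1) - f X)
      + of_nat (card {i \<in> S - {a}. ?V i}) * (f (X + 1) - f X)"
    using fin a by (simp add: sum.distrib sum.inter_filter[symmetric])
  finally show ?thesis
    unfolding card_births[OF assms(1)] card_deaths X_def by simp
qed

text \<open>Merging lengthens the cycle by at least one, so a cycle longer than \<open>m\<close> can
  end up of length at most \<open>Suc m\<close> only by a cut at one of the positions
  \<open>1\<close> to \<open>Suc m\<close>.\<close>

lemma card_step_orbit_le:
  "card {i \<in> S - {a}. card (orbit (Transposition.transpose a i \<circ> p) a) \<le> Suc m} \<le>
    Suc m + (if card (orbit p a) \<le> m then card S - 1 else 0)" (is "card ?W \<le> _")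
proof (cases "card (orbit p a) \<le> m")
  case True
  have "card ?W \<le> card (S - {a})" using fin by (intro card_mono) auto
  then show ?thesis using True a fin by simp
next
  case False
  have "?W \<subseteq> (\<lambda>q. (p ^^ q) a) ` {1..Suc m}"
  proof
    fix i assume i: "i \<in> ?W"
    then have "i \<in> orbit p a" using card_merge_orbit[OF fin a p, of i] False by force
    then obtain q where q: "0 < q" "q < card (orbit p a)" "i = (p ^^ q) a"
      using in_orbit_funpowE[OF fin a p] i by blast
    then show "i \<in> (\<lambda>q. (p ^^ q) a) ` {1..Suc m}"
      using card_split_orbit(1)[OF fin a p q(1,2)] i by auto
  qed
  then have "card ?W \<le> card ((\<lambda>q. (p ^^ q) a) ` {1..Suc m})" by (intro card_mono) auto
  also have "\<dots> \<le> Suc m" using card_image_le[of "{1..Suc m}" "\<lambda>q. (p ^^ q) a"] by simp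
  finally show ?thesis using False by simp
qed

end

section \<open>One step of the walk\<close>

abbreviation star_walk :: "nat \<Rightarrow> nat \<Rightarrow> (nat \<Rightarrow> nat) pmf" where
  "star_walk n k \<equiv> convolution_power_pmf (star_pmf n) k"

lemma convolution_pmf_eq_bind:
  "convolution_pmf P R = bind_pmf R (\<lambda>g. map_pmf (\<lambda>h. h \<circ> g) P)"
  unfolding convolution_pmf_def pair_pmf_def
  by (subst bind_commute_pmf) (simp add: map_bind_pmf map_pmf_def bind_assoc_pmf bind_return_pmf)

lemma finite_set_pmf_star_walk:
  assumes "n \<ge> 2"
  shows "finite (set_pmf (star_walk n k))"
  by (rule finite_subset[OF _ finite_permutations[of "{1..n}"]])
    (use set_pmf_star_walk_permutes[OF assms] in auto)

lemma integrable_star_walk: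
  fixes f :: "_ \<Rightarrow> 'b :: {banach, second_countable_topology}"
  assumes "n \<ge> 2"
  shows "integrable (measure_pmf (star_walk n k)) f"
  using finite_set_pmf_star_walk[OF assms] by (rule integrable_measure_pmf_finite)

lemma expectation_star_walk_Suc:
  fixes f :: "_ \<Rightarrow> 'b :: {banach, second_countable_topology}"
  assumes "n \<ge> 2"
  shows "measure_pmf.expectation (star_walk n (Suc k)) f =
    measure_pmf.expectation (star_walk n k)
      (\<lambda>p. (1 / real (n - 1)) *\<^sub>R (\<Sum>i\<in>{1..n} - {1}. f (Transposition.transpose 1 i \<circ> p)))"
proof -
  have ne: "star_transpositions n \<noteq> {}"
    using assms by (auto simp: star_transpositions_eq_image)
  have S: "{1..n} - {1} = {2..n}" by auto
  have *: "measure_pmf.expectation (map_pmf (\<lambda>h. h \<circ> g) (star_pmf n)) f =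
      (1 / real (n - 1)) *\<^sub>R (\<Sum>i\<in>{1..n} - {1}. f (Transposition.transpose 1 i \<circ> g))" for g
  proof -
    have "measure_pmf.expectation (map_pmf (\<lambda>h. h \<circ> g) (star_pmf n)) f =
        (\<Sum>h\<in>star_transpositions n. (1 / real (n - 1)) *\<^sub>R f (h \<circ> g))"
      unfolding integral_map_pmf star_pmf_def
      by (subst integral_measure_pmf[of "star_transpositions n"])
        (auto simp: ne card_star_transpositions indicator_def)
    also have "\<dots> = (\<Sum>i\<in>{2..n}. (1 / real (n - 1)) *\<^sub>R f (Transposition.transpose 1 i \<circ> g))"
      unfolding star_transpositions_eq_image by (subst sum.reindex[OF inj_transpose_1]) simp
    finally show ?thesis unfolding S scaleR_sum_right .
  qed
  note fin = finite_set_pmf_star_walk[OF assms, of k]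
  have "measure_pmf.expectation (star_walk n (Suc k)) f =
      (\<Sum>g\<in>set_pmf (star_walk n k). pmf (star_walk n k) g *\<^sub>R
        measure_pmf.expectation (map_pmf (\<lambda>h. h \<circ> g) (star_pmf n)) f)"
    unfolding convolution_power_pmf.simps convolution_pmf_eq_bind
    by (rule pmf_expectation_bind[OF fin]) (simp_all add: star_pmf_def ne)
  also have "\<dots> = measure_pmf.expectation (star_walk n k)
      (\<lambda>p. (1 / real (n - 1)) *\<^sub>R (\<Sum>i\<in>{1..n} - {1}. f (Transposition.transpose 1 i \<circ> p)))"
    unfolding * by (rule integral_measure_pmf[OF fin, symmetric]) auto
  finally show ?thesis .
qed

lemma expectation_star_walk_mono:
  fixes f g :: "_ \<Rightarrow> real"
  assumes "n \<ge> 2" "\<And>p. p permutes {1..n} \<Longrightarrow> f p \<le> g p"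
  shows "measure_pmf.expectation (star_walk n k) f \<le> measure_pmf.expectation (star_walk n k) g"
  by (rule integral_mono_AE[OF integrable_star_walk[OF assms(1)] integrable_star_walk[OF assms(1)]])
    (use assms(2) set_pmf_star_walk_permutes[OF assms(1)] in \<open>auto simp: AE_measure_pmf_iff\<close>)

lemma cycles_avoiding_id:
  fixes S :: "'a set"
  assumes "j \<ge> 2"
  shows "cycles_avoiding S a j id = {}"
proof -
  have "card C = 1" if C: "cyclic_on id C" for C :: "'a set"
  proof -
    obtain x where "C = orbit id x" using C by (auto simp: cyclic_on_def)
    moreover have "orbit id x = {x}" by (simp add: orbit_eq_singleton_iff)
    ultimately show ?thesis by simp
  qed
  then show ?thesis using assms by (force simp: cycles_avoiding_def)
qed

section \<open>An exponential moment and the probability of a short cycle through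
  \<open>1\<close>\<close>

abbreviation star_cycles :: "nat \<Rightarrow> nat \<Rightarrow> (nat \<Rightarrow> nat) \<Rightarrow> nat" where
  "star_cycles n j p \<equiv> card (cycles_avoiding {1..n} 1 j p)"

text \<open>Deaths only decrease \<open>2 ^ X\<close>, and at most one of the \<open>n - 1\<close>
  choices doubles it. This moment controls the factor \<open>2 ^ x\<close> in the later error
  bounds.\<close>

lemma expectation_two_power_star_cycles:
  assumes "n \<ge> 2" "j \<ge> 2"
  shows "measure_pmf.expectation (star_walk n k) (\<lambda>p. 2 ^ star_cycles n j p)
    \<le> (1 + 1 / real (n - 1)) ^ k"
proof (induction k)
  case 0
  then show ?case by (simp add: cycles_avoiding_id[OF assms(2), unfolded id_def] id_def)
next
  case (Suc k)
  have "measure_pmf.expectation (star_walk n (Suc k)) (\<lambda>p. 2 ^ star_cycles n j p :: real)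
    \<le> measure_pmf.expectation (star_walk n k) (\<lambda>p. (1 + 1 / real (n - 1)) * 2 ^ star_cycles n j p)"
    unfolding expectation_star_walk_Suc[OF assms(1)]
  proof (rule expectation_star_walk_mono[OF assms(1)])
    fix p :: "nat \<Rightarrow> nat" assume p: "p permutes {1..n}"
    define x where "x = star_cycles n j p"
    have "(\<Sum>i\<in>{1..n} - {1}. 2 ^ star_cycles n j (Transposition.transpose 1 i \<circ> p)) =
        real (n - 1) * 2 ^ x + real (j * x) * (2 ^ (x - 1) - 2 ^ x) +
        (if j < card (orbit p 1) then 2 ^ (x + 1) - 2 ^ x else 0)"
      using sum_step_cycles_avoiding[of "{1..n}" 1 p j "\<lambda>x. 2 ^ x :: real"] p assms
      by (simp add: x_def)
    also have "\<dots> \<le> real (n - 1) * 2 ^ x + 0 + 2 ^ x"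
      by (intro add_mono mult_nonneg_nonpos) (auto intro: power_increasing)
    finally have "(\<Sum>i\<in>{1..n} - {1}. 2 ^ star_cycles n j (Transposition.transpose 1 i \<circ> p)) \<le>
        (real (n - 1) + 1) * 2 ^ x" by (simp add: algebra_simps)
    then have "(1 / real (n - 1)) *
        (\<Sum>i\<in>{1..n} - {1}. 2 ^ star_cycles n j (Transposition.transpose 1 i \<circ> p)) \<le>
        (1 / real (n - 1)) * ((real (n - 1) + 1) * 2 ^ x)"
      by (intro mult_left_mono) auto
    also have "\<dots> = (1 + 1 / real (n - 1)) * 2 ^ x"
      using assms by (simp add: field_simps)
    finally show "(1 / real (n - 1)) *\<^sub>R
        (\<Sum>i\<in>{1..n} - {1}. 2 ^ star_cycles n j (Transposition.transpose 1 i \<circ> p)) \<le>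
        (1 + 1 / real (n - 1)) * 2 ^ star_cycles n j p" by (simp add: x_def)
  qed
  also have "\<dots> = (1 + 1 / real (n - 1)) *
      measure_pmf.expectation (star_walk n k) (\<lambda>p. 2 ^ star_cycles n j p)"
    by simp
  also have "\<dots> \<le> (1 + 1 / real (n - 1)) * (1 + 1 / real (n - 1)) ^ k"
    using Suc.IH by (intro mult_left_mono) auto
  finally show ?case by simp
qed

text \<open>Going back one step lowers the threshold by one at cost \<open>Suc m / (n - 1)\<close>,
  and no orbit has size \<open>0\<close>. The \<open>m\<close> steps back require
  \<open>m \<le> k\<close>; the costs \<open>1 + ... + m\<close> are at most the square of
  \<open>m\<close>.\<close>

lemma expectation_short_orbit:
  assumes "n \<ge> 2" "m \<le> k"
  shows "measure_pmf.expectation (star_walk n k) (\<lambda>p. of_bool (card (orbit p 1) \<le> m))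
    \<le> (real m)\<^sup>2 / real (n - 1)"
  using assms(2)
proof (induction m arbitrary: k)
  case 0
  have "measure_pmf.expectation (star_walk n k) (\<lambda>p. of_bool (card (orbit p 1) \<le> 0)) \<le>
      measure_pmf.expectation (star_walk n k) (\<lambda>p. 0 :: real)"
    by (rule expectation_star_walk_mono[OF assms(1)])
      (use card_orbit_pos[of _ "{1..n}" 1] in auto)
  then show ?case by simp
next
  case (Suc m)
  then obtain l where k: "k = Suc l" and l: "m \<le> l" by (cases k) auto
  have "measure_pmf.expectation (star_walk n k) (\<lambda>p. of_bool (card (orbit p 1) \<le> Suc m) :: real) \<le>
      measure_pmf.expectation (star_walk n l)
        (\<lambda>p. real (Suc m) / real (n - 1) + of_bool (card (orbit p 1) \<le> m))"
    unfolding k expectation_star_walk_Suc[OF assms(1)]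
  proof (rule expectation_star_walk_mono[OF assms(1)])
    fix p :: "nat \<Rightarrow> nat" assume p: "p permutes {1..n}"
    have "(\<Sum>i\<in>{1..n} - {1}. of_bool (card (orbit (Transposition.transpose 1 i \<circ> p) 1) \<le> Suc m) :: real)
      = real (card {i \<in> {1..n} - {1}. card (orbit (Transposition.transpose 1 i \<circ> p) 1) \<le> Suc m})"
      by (simp add: of_bool_def sum.inter_filter[symmetric])
    also have "\<dots> \<le> real (Suc m + (if card (orbit p 1) \<le> m then card {1..n} - 1 else 0))"
      using card_step_orbit_le[of "{1..n}" 1 p m] p assms(1) by (intro of_nat_mono) auto
    finally have "(1 / real (n - 1)) *
        (\<Sum>i\<in>{1..n} - {1}. of_bool (card (orbit (Transposition.transpose 1 i \<circ> p) 1) \<le> Suc m)) \<le>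
        (1 / real (n - 1)) * real (Suc m + (if card (orbit p 1) \<le> m then card {1..n} - 1 else 0))"
      by (intro mult_left_mono) auto
    also have "\<dots> = real (Suc m) / real (n - 1) + of_bool (card (orbit p 1) \<le> m)"
      using assms(1) by (simp add: field_simps)
    finally show "(1 / real (n - 1)) *\<^sub>R
        (\<Sum>i\<in>{1..n} - {1}. of_bool (card (orbit (Transposition.transpose 1 i \<circ> p) 1) \<le> Suc m)) \<le>
        real (Suc m) / real (n - 1) + of_bool (card (orbit p 1) \<le> m)" by simp
  qed
  also have "\<dots> = real (Suc m) / real (n - 1) +
      measure_pmf.expectation (star_walk n l) (\<lambda>p. of_bool (card (orbit p 1) \<le> m))"
    by (subst Bochner_Integration.integral_add) (auto intro!: integrable_star_walk assms)
  also have "\<dots> \<le> real (Suc m) / real (n - 1) + (real m)\<^sup>2 / real (n - 1)"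
    using Suc.IH[OF l] by simp
  also have "\<dots> \<le> (real (Suc m))\<^sup>2 / real (n - 1)"
    unfolding add_divide_distrib[symmetric]
    by (intro divide_right_mono) (auto simp: power2_eq_square algebra_simps)
  finally show ?case .
qed

section \<open>Second-order estimates for powers in the unit disc\<close>

lemma norm_power_second_difference:
  fixes a b :: "'a :: real_normed_field"
  assumes "norm a \<le> 1" "norm b \<le> 1"
  shows "norm (a ^ x - b ^ x - of_nat x * (a - b) * b ^ (x - 1)) \<le> 2 ^ x * (norm (a - b))\<^sup>2"
proof (induction x)
  case (Suc x)
  \<comment> \<open>The remainder satisfies
    \<open>R (Suc x) = a * R x + x * (a - b)^2 * b ^ (x - 1)\<close>. With \<open>x < 2 ^ x\<close>
    both terms fit under \<open>2 ^ x\<close>, which doubles at each step.\<close>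
  have "a ^ Suc x - b ^ Suc x - of_nat (Suc x) * (a - b) * b ^ (Suc x - 1) =
    a * (a ^ x - b ^ x - of_nat x * (a - b) * b ^ (x - 1)) + of_nat x * (a - b)\<^sup>2 * b ^ (x - 1)"
    by (cases x) (simp_all add: algebra_simps power2_eq_square)
  also have "norm \<dots> \<le> norm a * norm (a ^ x - b ^ x - of_nat x * (a - b) * b ^ (x - 1)) +
      real x * (norm (a - b))\<^sup>2 * norm b ^ (x - 1)"
    by (intro norm_triangle_mono) (simp_all add: norm_mult norm_power)
  also have "\<dots> \<le> 1 * (2 ^ x * (norm (a - b))\<^sup>2) + 2 ^ x * (norm (a - b))\<^sup>2 * 1"
    using assms Suc.IH of_nat_less_two_power[of x, where 'a = real]
    by (intro add_mono mult_mono power_le_one) auto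
  finally show ?case by (simp add: algebra_simps)
qed simp

text \<open>Pointwise form of the step identity: the first expression is the conditional mean of
  \<open>(1 + u) ^ X\<close> after one step from \<open>X = x\<close>, and \<open>b\<close> says
  whether a birth is possible. Deaths contract \<open>u\<close> by \<open>1 - j * e\<close>, and
  immigration contributes \<open>exp (e * u)\<close>.\<close>

lemma norm_step_minus_exp_le:
  fixes u :: complex and e :: real and x j :: nat and b :: bool
  assumes u: "norm (1 + u) \<le> 1" and e: "0 \<le> e" "e \<le> 1" "real j * e \<le> 1"
  defines "K \<equiv> 4 * (real j)\<^sup>2 + 4 * real j + 4 * exp 2"
  shows "norm ((1 + u) ^ x +
      of_real e * (of_nat (j * x) * ((1 + u) ^ (x - 1) - (1 + u) ^ x) +
        (if b then (1 + u) ^ (x + 1) - (1 + u) ^ x else 0))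
      - exp (of_real e * u) * (1 + u * of_real (1 - real j * e)) ^ x)
    \<le> K * e\<^sup>2 * 2 ^ x + 2 * e * of_bool (\<not> b)"
proof -
  define w where "w = 1 + u"
  define w' where "w' = 1 + u * of_real (1 - real j * e)"
  have w: "norm w \<le> 1" using u by (simp add: w_def)
  have nu: "norm u \<le> 2"
    using norm_triangle_ineq4[of w 1] w by (simp add: w_def)
  have re: "\<bar>Re u\<bar> \<le> 2" using abs_Re_le_cmod[of u] nu by linarith
  have w': "norm w' \<le> 1"
  proof -
    \<comment> \<open>\<open>w'\<close> is a convex combination of \<open>w\<close> and
      \<open>1\<close>, hence stays in the unit disc.\<close>
    have "w' = of_real (1 - real j * e) * w + of_real (real j * e)"
      by (simp add: w_def w'_def algebra_simps)
    also have "norm \<dots> \<le> (1 - real j * e) * norm w + real j * e"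
      using e by (intro norm_triangle_mono) (simp_all add: norm_mult del: of_real_mult of_real_diff)
    also have "\<dots> \<le> (1 - real j * e) * 1 + real j * e"
      using e w by (intro add_mono mult_left_mono) auto
    finally show ?thesis by simp
  qed
  have diff: "w' - w = - (of_nat j * of_real e * u)"
    by (simp add: w_def w'_def algebra_simps)
  have ndiff: "norm (w' - w) \<le> 2 * real j * e"
    using mult_left_mono[OF nu, of "real j * e"] e unfolding diff by (simp add: norm_mult mult_ac)
  have x2: "real x \<le> 2 ^ x" using of_nat_less_two_power[of x, where 'a = real] by simp
  \<comment> \<open>Four errors: \<open>A\<close> linearises the deaths, \<open>B\<close> linearises
    the exponential, \<open>C\<close> replaces \<open>w'\<close> by \<open>w\<close> in the
    immigration term, and \<open>D\<close> is the birth missing when \<open>b\<close> fails.\<close>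
  define A where "A = w' ^ x - w ^ x - of_nat x * (w' - w) * w ^ (x - 1)"
  define B where "B = (exp (of_real e * u) - (1 + of_real e * u)) * w' ^ x"
  define C where "C = of_real e * u * (w' ^ x - w ^ x)"
  define D where "D = of_real e * u * (if b then 0 else w ^ x)"
  have "(1 + u) ^ x +
      of_real e * (of_nat (j * x) * ((1 + u) ^ (x - 1) - (1 + u) ^ x) +
        (if b then (1 + u) ^ (x + 1) - (1 + u) ^ x else 0))
      - exp (of_real e * u) * (1 + u * of_real (1 - real j * e)) ^ x = - A - B - C - D"
  proof -
    have u_eq: "u = w - 1" by (simp add: w_def)
    have "of_real e * (of_nat (j * x) * (w ^ (x - 1) - w ^ x)) = of_nat x * (w' - w) * w ^ (x - 1)"
      unfolding diff u_eq by (cases x) (simp_all add: algebra_simps)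
    then show ?thesis
      unfolding w_def[symmetric] w'_def[symmetric] A_def B_def C_def D_def
      by (cases b) (simp_all add: algebra_simps u_eq)
  qed
  also have "norm \<dots> \<le> norm A + norm B + norm C + norm D"
    by (metis (no_types, opaque_lifting) add_mono norm_minus_cancel norm_triangle_ineq4
        order_refl order_trans)
  \<comment> \<open>The three summands of \<open>K\<close> come from \<open>A\<close>,
    \<open>C\<close> and \<open>B\<close>; \<open>exp 2\<close> bounds the Taylor remainder because
    \<open>e * u\<close> has norm at most \<open>2\<close>.\<close>
  also have "\<dots> \<le> (4 * (real j)\<^sup>2 * e\<^sup>2 * 2 ^ x) + (4 * exp 2 * e\<^sup>2 * 2 ^ x) +
      (4 * real j * e\<^sup>2 * 2 ^ x) + 2 * e * of_bool (\<not> b)"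
  proof (intro add_mono)
    have "norm A \<le> 2 ^ x * (norm (w' - w))\<^sup>2"
      unfolding A_def by (rule norm_power_second_difference[OF w' w])
    also have "\<dots> \<le> 2 ^ x * (2 * real j * e)\<^sup>2"
      using ndiff by (intro mult_left_mono power_mono) auto
    finally show "norm A \<le> 4 * (real j)\<^sup>2 * e\<^sup>2 * 2 ^ x" by (simp add: power_mult_distrib mult_ac)
  next
    have "norm (exp (of_real e * u) - (1 + of_real e * u)) \<le>
        exp \<bar>Re (of_real e * u)\<bar> * (norm (of_real e * u))\<^sup>2"
      using Taylor_exp[of "of_real e * u" 1] by (simp add: power2_eq_square)
    also have "\<dots> \<le> exp 2 * (e * 2)\<^sup>2"
    proof (intro mult_mono power_mono)
      have "\<bar>Re (of_real e * u)\<bar> = e * \<bar>Re u\<bar>" using e by (simp add: abs_mult)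
      also have "\<dots> \<le> 1 * 2" using e re by (intro mult_mono) auto
      finally show "exp \<bar>Re (of_real e * u)\<bar> \<le> exp 2" by simp
      show "norm (of_real e * u) \<le> e * 2" using e nu by (simp add: norm_mult mult_left_mono)
    qed auto
    finally have "norm B \<le> exp 2 * (e * 2)\<^sup>2 * 1"
      unfolding B_def norm_mult norm_power using w' by (intro mult_mono power_le_one) auto
    also have "\<dots> \<le> exp 2 * (e * 2)\<^sup>2 * 2 ^ x" by (intro mult_left_mono) auto
    finally show "norm B \<le> 4 * exp 2 * e\<^sup>2 * 2 ^ x" by (simp add: power_mult_distrib mult_ac)
  next
    have "norm (w' ^ x - w ^ x) \<le> real x * norm (w' - w)"
      by (rule norm_power_diff[OF w' w])
    also have "\<dots> \<le> 2 ^ x * (2 * real j * e)" using x2 ndiff by (intro mult_mono) auto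
    finally have "norm C \<le> (e * 2) * (2 ^ x * (2 * real j * e))"
      unfolding C_def norm_mult using e nu by (intro mult_mono) auto
    then show "norm C \<le> 4 * real j * e\<^sup>2 * 2 ^ x" by (simp add: power2_eq_square mult_ac)
  next
    have "norm D \<le> (e * 2) * of_bool (\<not> b)"
      unfolding D_def norm_mult using e nu w
      by (intro mult_mono) (auto simp: norm_power power_le_one)
    then show "norm D \<le> 2 * e * of_bool (\<not> b)" by (simp add: mult_ac)
  qed
  finally show ?thesis by (simp add: K_def algebra_simps)
qed

lemma norm_expectation_step:
  fixes u :: complex
  assumes n: "n \<ge> 2" and j: "j \<ge> 2" "j \<le> n - 1" and u: "norm (1 + u) \<le> 1"
  defines "e \<equiv> 1 / real (n - 1)"
    and "K \<equiv> 4 * (real j)\<^sup>2 + 4 * real j + 4 * exp 2"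
  shows "norm (measure_pmf.expectation (star_walk n (Suc k)) (\<lambda>p. (1 + u) ^ star_cycles n j p) -
      exp (of_real e * u) * measure_pmf.expectation (star_walk n k)
        (\<lambda>p. (1 + u * of_real (1 - real j * e)) ^ star_cycles n j p))
    \<le> K * e\<^sup>2 * (1 + e) ^ k + 2 * e *
      measure_pmf.expectation (star_walk n k) (\<lambda>p. of_bool (card (orbit p 1) \<le> j))"
proof -
  let ?E = "\<lambda>f. measure_pmf.expectation (star_walk n k) f"
  note int = integrable_star_walk[OF n]
  have e: "0 \<le> e" "e \<le> 1" "real j * e \<le> 1"
    using n j by (auto simp: e_def field_simps)
  define g where "g = (\<lambda>p. (1 / real (n - 1)) *\<^sub>R
    (\<Sum>i\<in>{1..n} - {1}. (1 + u) ^ star_cycles n j (Transposition.transpose 1 i \<circ> p)))"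
  define h where "h = (\<lambda>p. exp (of_real e * u) * (1 + u * of_real (1 - real j * e)) ^ star_cycles n j p)"
  have bound: "norm (g p - h p) \<le> K * e\<^sup>2 * 2 ^ star_cycles n j p + 2 * e * of_bool (card (orbit p 1) \<le> j)"
    if p: "p permutes {1..n}" for p
  proof -
    define x where "x = star_cycles n j p"
    define b where "b \<longleftrightarrow> j < card (orbit p 1)"
    have "(\<Sum>i\<in>{1..n} - {1}. (1 + u) ^ star_cycles n j (Transposition.transpose 1 i \<circ> p)) =
        of_nat (n - 1) * (1 + u) ^ x + of_nat (j * x) * ((1 + u) ^ (x - 1) - (1 + u) ^ x) +
        (if b then (1 + u) ^ (x + 1) - (1 + u) ^ x else 0)"
      using sum_step_cycles_avoiding[of "{1..n}" 1 p j "\<lambda>x. (1 + u) ^ x"] p n j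
      by (simp add: x_def b_def)
    then have "g p = (1 + u) ^ x + of_real e * (of_nat (j * x) * ((1 + u) ^ (x - 1) - (1 + u) ^ x) +
        (if b then (1 + u) ^ (x + 1) - (1 + u) ^ x else 0))"
      using n by (simp add: g_def e_def scaleR_conv_of_real field_simps)
    then show ?thesis
      using norm_step_minus_exp_le[OF u e, of x b] unfolding h_def K_def x_def b_def not_less by simp
  qed
  have "measure_pmf.expectation (star_walk n (Suc k)) (\<lambda>p. (1 + u) ^ star_cycles n j p) -
      exp (of_real e * u) * ?E (\<lambda>p. (1 + u * of_real (1 - real j * e)) ^ star_cycles n j p) =
      ?E (\<lambda>p. g p - h p)"
    unfolding expectation_star_walk_Suc[OF n] g_def[symmetric] h_def
    by (subst Bochner_Integration.integral_diff) (auto intro!: int)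
  also have "norm \<dots> \<le> ?E (\<lambda>p. norm (g p - h p))"
    by (rule integral_norm_bound)
  also have "\<dots> \<le> ?E (\<lambda>p. K * e\<^sup>2 * 2 ^ star_cycles n j p + 2 * e * of_bool (card (orbit p 1) \<le> j))"
    by (rule expectation_star_walk_mono[OF n bound])
  also have "\<dots> = K * e\<^sup>2 * ?E (\<lambda>p. 2 ^ star_cycles n j p) +
      2 * e * ?E (\<lambda>p. of_bool (card (orbit p 1) \<le> j))"
    by (subst Bochner_Integration.integral_add) (auto intro!: int)
  also have "\<dots> \<le> K * e\<^sup>2 * (1 + e) ^ k + 2 * e * ?E (\<lambda>p. of_bool (card (orbit p 1) \<le> j))"
    using expectation_two_power_star_cycles[OF n j(1), of k]
    by (intro add_right_mono mult_left_mono) (auto simp: K_def e_def)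
  finally show ?thesis .
qed

section \<open>The Poisson limit\<close>

text \<open>Removing the last step multiplies the argument by \<open>r\<close>, that is, raises
  \<open>s\<close> by one; hence the induction needs all \<open>s\<close> at once. At time
  \<open>0\<close> the identity has no \<open>j\<close>-cycle, so both sides are
  \<open>1\<close>.\<close>

lemma norm_pgf_telescope:
  fixes z :: complex
  assumes n: "n \<ge> 2" and j: "j \<ge> 2" "j \<le> n - 1" and z: "norm z \<le> 1"
  defines "e \<equiv> 1 / real (n - 1)"
    and "K \<equiv> 4 * (real j)\<^sup>2 + 4 * real j + 4 * exp 2"
  defines "r \<equiv> 1 - real j * e"
  shows "norm (measure_pmf.expectation (star_walk n m)
        (\<lambda>p. (1 + (z - 1) * of_real (r ^ s)) ^ star_cycles n j p) -
      exp (of_real e * (\<Sum>i<m. (z - 1) * of_real (r ^ (s + i)))))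
    \<le> (\<Sum>k<m. K * e\<^sup>2 * (1 + e) ^ k + 2 * e *
      measure_pmf.expectation (star_walk n k) (\<lambda>p. of_bool (card (orbit p 1) \<le> j)))"
proof (induction m arbitrary: s)
  case 0
  then show ?case by (simp add: cycles_avoiding_id[OF j(1), unfolded id_def] id_def)
next
  case (Suc m)
  define u where "u s = (z - 1) * of_real (r ^ s)" for s
  define E where "E m s = measure_pmf.expectation (star_walk n m) (\<lambda>p. (1 + u s) ^ star_cycles n j p)"
    for m s
  define G where "G m s = exp (of_real e * (\<Sum>i<m. u (s + i)))" for m s
  have e: "0 \<le> e" "real j * e \<le> 1"
    using n j by (auto simp: e_def field_simps)
  have r: "0 \<le> r ^ s" "r ^ s \<le> 1" for s
    using e by (auto simp: r_def power_le_one)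
  have u: "norm (1 + u s) \<le> 1" for s
  proof -
    have "1 + u s = of_real (1 - r ^ s) + of_real (r ^ s) * z"
      by (simp add: u_def algebra_simps)
    also have "norm \<dots> \<le> (1 - r ^ s) + r ^ s * norm z"
      using r[of s] by (intro norm_triangle_mono)
        (simp_all add: norm_mult del: of_real_mult of_real_diff of_real_power)
    also have "\<dots> \<le> (1 - r ^ s) + r ^ s * 1"
      using r z by (intro add_mono mult_left_mono) auto
    finally show ?thesis by simp
  qed
  have step: "1 + u s * of_real (1 - real j * e) = 1 + u (Suc s)"
    by (simp add: u_def r_def)
  \<comment> \<open>Since \<open>1 + u s\<close> lies in the unit disc, \<open>Re (u s)\<close> is
    at most \<open>0\<close>; earlier errors are therefore not amplified.\<close>
  have nexp: "norm (exp (of_real e * u s)) \<le> 1"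
    using complex_Re_le_cmod[of "1 + u s"] u[of s] e by (simp add: mult_nonneg_nonpos)
  have "G (Suc m) s = exp (of_real e * u s) * G m (Suc s)"
    unfolding G_def sum.lessThan_Suc_shift by (simp add: exp_add ring_distribs)
  then have "E (Suc m) s - G (Suc m) s = (E (Suc m) s - exp (of_real e * u s) * E m (Suc s)) +
      exp (of_real e * u s) * (E m (Suc s) - G m (Suc s))"
    by (simp add: algebra_simps)
  also have "norm \<dots> \<le> norm (E (Suc m) s - exp (of_real e * u s) * E m (Suc s)) +
      1 * norm (E m (Suc s) - G m (Suc s))"
    using nexp by (intro norm_triangle_mono order_refl) (auto simp: norm_mult intro!: mult_left_le_one_le)
  also have "\<dots> \<le> (K * e\<^sup>2 * (1 + e) ^ m + 2 * e *
      measure_pmf.expectation (star_walk n m) (\<lambda>p. of_bool (card (orbit p 1) \<le> j))) +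
      (\<Sum>k<m. K * e\<^sup>2 * (1 + e) ^ k + 2 * e *
      measure_pmf.expectation (star_walk n k) (\<lambda>p. of_bool (card (orbit p 1) \<le> j)))"
    using norm_expectation_step[OF n j u[of s], of m, folded e_def K_def, unfolded step] Suc.IH[of "Suc s"]
    by (simp add: E_def G_def u_def)
  finally show ?case by (simp add: E_def G_def u_def)
qed

lemma norm_pgf_star_cycles:
  fixes z :: complex
  assumes n: "n \<ge> 2" and j: "j \<ge> 2" "j \<le> n - 1" and z: "norm z \<le> 1"
  defines "e \<equiv> 1 / real (n - 1)"
    and "K \<equiv> 4 * (real j)\<^sup>2 + 4 * real j + 4 * exp 2"
  shows "norm (measure_pmf.expectation (star_walk n m) (\<lambda>p. z ^ star_cycles n j p) -
      exp ((z - 1) * of_real ((1 - (1 - real j * e) ^ m) / real j)))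
    \<le> K * (real m * e) * e * exp (real m * e) + 2 * e * (real j + real m * e * (real j)\<^sup>2)"
proof -
  define r where "r = 1 - real j * e"
  define q where "q k = measure_pmf.expectation (star_walk n k) (\<lambda>p. of_bool (card (orbit p 1) \<le> j) :: real)" for k
  have e: "0 < e" using n by (simp add: e_def)
  have K: "0 \<le> K" by (simp add: K_def)
  \<comment> \<open>The accumulated exponents form a geometric series with
    \<open>1 - r = j * e\<close>.\<close>
  have "1 - r ^ m = real j * e * (\<Sum>i<m. r ^ i)"
    using one_diff_power_eq[of r m] by (simp add: r_def)
  then have "(1 - r ^ m) / real j = e * (\<Sum>i<m. r ^ i)"
    using j by (simp add: field_simps)
  then have "(z - 1) * of_real ((1 - r ^ m) / real j) = of_real e * (\<Sum>i<m. (z - 1) * of_real (r ^ i))"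
    by (simp add: sum_distrib_left mult_ac del: of_real_divide)
  then have "norm (measure_pmf.expectation (star_walk n m) (\<lambda>p. z ^ star_cycles n j p) -
      exp ((z - 1) * of_real ((1 - r ^ m) / real j))) \<le> (\<Sum>k<m. K * e\<^sup>2 * (1 + e) ^ k + 2 * e * q k)"
    using norm_pgf_telescope[OF n j z, of m 0, folded e_def K_def, folded r_def q_def] by simp
  \<comment> \<open>The short-cycle bound holds only from time \<open>j\<close> on; the at most
    \<open>j\<close> earlier times use the trivial bound \<open>1\<close>, which yields the summand
    \<open>real j\<close> below.\<close>
  also have "\<dots> \<le> (\<Sum>k<m. K * e\<^sup>2 * exp (real m * e) + 2 * e * (of_bool (k < j) + (real j)\<^sup>2 * e))"
  proof (intro sum_mono add_mono mult_left_mono)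
    fix k assume k: "k \<in> {..<m}"
    have "(1 + e) ^ k \<le> exp e ^ k" using e by (intro power_mono) auto
    also have "\<dots> = exp (real k * e)" by (simp add: exp_of_nat_mult)
    also have "\<dots> \<le> exp (real m * e)" using k e by simp
    finally show "(1 + e) ^ k \<le> exp (real m * e)" .
    show "q k \<le> of_bool (k < j) + (real j)\<^sup>2 * e"
    proof (cases "k < j")
      case True
      have "q k \<le> measure_pmf.expectation (star_walk n k) (\<lambda>_. 1)"
        unfolding q_def by (rule expectation_star_walk_mono[OF n]) simp
      also have "\<dots> \<le> 1 + (real j)\<^sup>2 * e" using e by simp
      finally show ?thesis using True by simp
    next
      case False
      then show ?thesis using expectation_short_orbit[OF n, of j k] by (simp add: q_def e_def)
    qed
  qed (use e K in auto)
  also have "\<dots> = K * (real m * e) * e * exp (real m * e) +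
      2 * e * ((\<Sum>k<m. of_bool (k < j)) + real m * e * (real j)\<^sup>2)"
    by (simp add: sum.distrib sum_distrib_left[symmetric] power2_eq_square algebra_simps)
  also have "(\<Sum>k<m. of_bool (k < j)) \<le> real j"
  proof -
    have "(\<Sum>k<m. of_bool (k < j)) = real (card ({..<m} \<inter> {..<j}))"
      by (simp add: of_bool_def sum.inter_restrict[symmetric] sum.If_cases lessThan_def)
    also have "\<dots> \<le> real (card {..<j})" by (intro of_nat_mono card_mono) auto
    finally show ?thesis by simp
  qed
  finally show ?thesis using e by (simp add: r_def mult_left_mono add_mono)
qed

section \<open>Passing from cycles avoiding \<open>1\<close> to all cycles\<close>

lemma num_cycles_eq_star_cycles:
  assumes "p permutes {1..n}" "j < card (orbit p 1)"
  shows "num_cycles n j p = star_cycles n j p"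
proof -
  have "1 \<notin> C" if "card C = j" "cyclic_on p C" for C
    using orbit_cyclic_eq3[of p C 1] that assms(2) by auto
  then show ?thesis
    unfolding num_cycles_def cycles_avoiding_def by (intro arg_cong[where f = card]) auto
qed

lemma norm_pgf_num_cycles:
  fixes z :: complex
  assumes n: "n \<ge> 2" and z: "norm z \<le> 1" and m: "j \<le> m"
  shows "norm (measure_pmf.expectation (star_walk n m) (\<lambda>p. z ^ num_cycles n j p) -
      measure_pmf.expectation (star_walk n m) (\<lambda>p. z ^ star_cycles n j p))
    \<le> 2 * (real j)\<^sup>2 / real (n - 1)"
proof -
  let ?E = "\<lambda>f. measure_pmf.expectation (star_walk n m) f"
  note int = integrable_star_walk[OF n]
  have "?E (\<lambda>p. z ^ num_cycles n j p) - ?E (\<lambda>p. z ^ star_cycles n j p) =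
      ?E (\<lambda>p. z ^ num_cycles n j p - z ^ star_cycles n j p)"
    by (subst Bochner_Integration.integral_diff) (auto intro!: int)
  also have "norm \<dots> \<le> ?E (\<lambda>p. norm (z ^ num_cycles n j p - z ^ star_cycles n j p))"
    by (rule integral_norm_bound)
  also have "\<dots> \<le> ?E (\<lambda>p. 2 * of_bool (card (orbit p 1) \<le> j))"
  proof (rule expectation_star_walk_mono[OF n])
    fix p assume p: "p permutes {1..n}"
    \<comment> \<open>The two counts differ only when the cycle of \<open>1\<close> has length at
      most \<open>j\<close>, and then the powers of \<open>z\<close> differ by at most
      \<open>2\<close>.\<close>
    have "norm (z ^ a - z ^ b) \<le> 1 + 1" for a b
      using z by (intro order_trans[OF norm_triangle_ineq4] add_mono) (auto simp: norm_power power_le_one)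
    then show "norm (z ^ num_cycles n j p - z ^ star_cycles n j p) \<le> 2 * of_bool (card (orbit p 1) \<le> j)"
      using num_cycles_eq_star_cycles[OF p, of j] by (cases "card (orbit p 1) \<le> j") auto
  qed
  also have "\<dots> = 2 * ?E (\<lambda>p. of_bool (card (orbit p 1) \<le> j))" by simp
  also have "\<dots> \<le> 2 * ((real j)\<^sup>2 / real (n - 1))"
    by (intro mult_left_mono expectation_short_orbit n m) auto
  finally show ?thesis by simp
qed

section \<open>Generating and characteristic functions\<close>

lemma expectation_poisson_power:
  fixes z :: complex
  assumes l: "0 < l"
  shows "measure_pmf.expectation (poisson_pmf l) (\<lambda>k. z ^ k) = exp ((z - 1) * of_real l)"
proof -
  \<comment> \<open>Type-generic: the real instance at \<open>norm z\<close> gives absolute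
    summability, the complex one at \<open>z\<close> gives the value.\<close>
  have sums: "(\<lambda>k. pmf (poisson_pmf l) k *\<^sub>R w ^ k) sums (exp (- l) *\<^sub>R exp (of_real l * w))"
    for w :: "'a :: {real_normed_field, banach}"
    using sums_scaleR_right[OF exp_converges[of "of_real l * w"], of "exp (- l)"] l
    by (simp add: power_mult_distrib scaleR_conv_of_real field_simps)
  have "summable (\<lambda>k. norm (pmf (poisson_pmf l) k *\<^sub>R z ^ k))"
    using sums_summable[OF sums[of "norm z"]] l by (simp add: norm_power)
  then have "integrable (count_space UNIV) (\<lambda>k. pmf (poisson_pmf l) k *\<^sub>R z ^ k)"
    by (simp add: integrable_count_space_nat_iff)
  then have "measure_pmf.expectation (poisson_pmf l) (\<lambda>k. z ^ k) =
      (\<Sum>k. pmf (poisson_pmf l) k *\<^sub>R z ^ k)"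
    unfolding measure_pmf_eq_density
    by (subst integral_density) (auto simp: integral_count_space_nat)
  also have "\<dots> = exp (- l) *\<^sub>R exp (of_real l * z)"
    using sums by (rule sums_unique[symmetric])
  also have "\<dots> = exp ((z - 1) * of_real l)"
    by (simp add: scaleR_conv_of_real exp_of_real[symmetric] exp_add[symmetric] algebra_simps)
  finally show ?thesis .
qed

lemma char_distr_real_nat:
  "char (distr (measure_pmf M) borel (\<lambda>x. real (f x))) t = measure_pmf.expectation M (\<lambda>x. iexp t ^ f x)"
  unfolding char_def by (subst integral_distr) (simp_all add: exp_of_nat_mult[symmetric] mult_ac)

theorem theorem1p3:
  fixes j :: nat and c :: real
  assumes "j \<ge> 2" and "c > 0"
  shows "weak_conv_m
    (\<lambda>n. distr (measure_pmf (convolution_power_pmf (star_pmf n) (nat \<lfloor>c * real n\<rfloor>))) borel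
           (\<lambda>\<pi>. real (num_cycles n j \<pi>)))
    (distr (measure_pmf (poisson_pmf (1 / real j * (1 - exp (- real j * c))))) borel real)"
proof (rule levy_continuity)
  fix t :: real
  define z where "z = iexp t"
  define e where "e n = 1 / real (n - 1)" for n :: nat
  define m where "m n = nat \<lfloor>c * real n\<rfloor>" for n :: nat
  define l where "l = 1 / real j * (1 - exp (- real j * c))"
  define K where "K = 4 * (real j)\<^sup>2 + 4 * real j + 4 * exp 2"
  define a where "a n = measure_pmf.expectation (star_walk n (m n)) (\<lambda>p. z ^ num_cycles n j p)" for n
  define b where "b n = exp ((z - 1) * of_real ((1 - (1 - real j * e n) ^ m n) / real j))" for n
  \<comment> \<open>Sum of the two error bounds, for the generating function of
    \<open>star_cycles\<close> and for replacing it by \<open>num_cycles\<close>. Every summand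
    carries a factor \<open>e n\<close> beside quantities converging with
    \<open>m n * e n\<close>.\<close>
  define d where "d n = (K * (real (m n) * e n) * e n * exp (real (m n) * e n) +
      2 * e n * (real j + real (m n) * e n * (real j)\<^sup>2)) + 2 * (real j)\<^sup>2 * e n" for n
  have z: "norm z \<le> 1" by (simp add: z_def)
  have l: "0 < l" using assms by (simp add: l_def)
  have e: "e \<longlonglongrightarrow> 0" unfolding e_def by real_asymp
  have m_eq: "real (m n) = of_int \<lfloor>c * real n\<rfloor>" for n using assms by (simp add: m_def)
  have me: "(\<lambda>n. real (m n) * e n) \<longlonglongrightarrow> c"
    unfolding m_eq e_def using assms by real_asymp
  have m_top: "filterlim m at_top sequentially"
    unfolding m_def using assms by real_asymp
  have "d \<longlonglongrightarrow> K * c * 0 * exp c + 2 * 0 * (real j + c * (real j)\<^sup>2) + 2 * (real j)\<^sup>2 * 0"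
    unfolding d_def by (intro tendsto_intros e me)
  then have d: "d \<longlonglongrightarrow> 0" by simp
  \<comment> \<open>The strict \<open>j < n - 1\<close> makes \<open>1 - j * e n\<close> positive,
    so that its logarithm can be used; \<open>j \<le> m n\<close> serves the short-cycle
    bound.\<close>
  have large: "\<forall>\<^sub>F n in sequentially. n \<ge> 2 \<and> j < n - 1 \<and> j \<le> m n"
    using eventually_ge_at_top[of "j + 2"] filterlim_at_top[THEN iffD1, OF m_top, rule_format, of j]
    by eventually_elim auto
  have "\<forall>\<^sub>F n in sequentially. norm (a n - b n) \<le> d n"
    using large
  proof eventually_elim
    case (elim n)
    define s where "s = measure_pmf.expectation (star_walk n (m n)) (\<lambda>p. z ^ star_cycles n j p)"
    have "norm (s - b n) \<le> K * (real (m n) * e n) * e n * exp (real (m n) * e n) +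
        2 * e n * (real j + real (m n) * e n * (real j)\<^sup>2)"
      unfolding s_def b_def e_def K_def by (rule norm_pgf_star_cycles) (use elim assms z in auto)
    moreover have "norm (a n - s) \<le> 2 * (real j)\<^sup>2 * e n"
      using norm_pgf_num_cycles[of n z j "m n"] elim z by (simp add: a_def s_def e_def)
    moreover have "norm (a n - b n) \<le> norm (a n - s) + norm (s - b n)"
      using norm_triangle_ineq[of "a n - s" "s - b n"] by simp
    ultimately show ?case unfolding d_def by linarith
  qed
  then have ab: "(\<lambda>n. a n - b n) \<longlonglongrightarrow> 0"
    using d by (rule Lim_null_comparison)
  \<comment> \<open>The power is written as the exponential of \<open>m n * e n\<close>, tending to
    \<open>c\<close>, times this quotient, tending to \<open>- j\<close>.\<close>
  have ln: "(\<lambda>n. ln (1 - real j * e n) / e n) \<longlonglongrightarrow> - real j"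
    unfolding e_def using assms by real_asymp
  have "(\<lambda>n. exp ((real (m n) * e n) * (ln (1 - real j * e n) / e n))) \<longlonglongrightarrow> exp (c * - real j)"
    by (intro tendsto_intros me ln)
  moreover have "\<forall>\<^sub>F n in sequentially. exp ((real (m n) * e n) * (ln (1 - real j * e n) / e n)) =
      (1 - real j * e n) ^ m n"
    using large
  proof eventually_elim
    case (elim n)
    then have "0 < e n" "0 < 1 - real j * e n" by (auto simp: e_def field_simps)
    then show ?case by (simp add: exp_of_nat_mult)
  qed
  ultimately have "(\<lambda>n. (1 - real j * e n) ^ m n) \<longlonglongrightarrow> exp (c * - real j)"
    by (rule Lim_transform_eventually)
  then have "b \<longlonglongrightarrow> exp ((z - 1) * of_real ((1 - exp (c * - real j)) / real j))"
    unfolding b_def using assms by (intro tendsto_intros) auto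
  from tendsto_add[OF ab this] have "a \<longlonglongrightarrow> exp ((z - 1) * of_real l)"
    by (simp add: l_def mult.commute)
  then show "(\<lambda>n. char (distr (measure_pmf (star_walk n (nat \<lfloor>c * real n\<rfloor>))) borel
      (\<lambda>\<pi>. real (num_cycles n j \<pi>))) t)
    \<longlonglongrightarrow> char (distr (measure_pmf (poisson_pmf (1 / real j * (1 - exp (- real j * c))))) borel real) t"
    \<comment> \<open>The instance at the identity treats the Poisson side, whose law is pushed
      forward by \<open>real\<close> itself.\<close>
    unfolding char_distr_real_nat[of _ "\<lambda>x. x", simplified] char_distr_real_nat l_def[symmetric]
      expectation_poisson_power[OF l] a_def m_def z_def .
qed (auto intro!: prob_space.real_distribution_distr measure_pmf.prob_space_axioms)

end
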